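(* Let $l,m\in\mathbb{N}$ with $l<m$, and let $k=(k_1,\dots,k_m)\in K_m$. Consider the mapping $$H_k: X_l\to G_{l,m}$$ sending $x=(x_1,\dots,x_l)\in X_l$ to the $l$-dimensional subspace of $\mathbb{R}^m$ generated by the vectors $$v_k(x_i)=(I_{k_1}(x_i),\dots,I_{k_m}(x_i)),\qquad i=1,\dots,l.$$ Then $H_k$ is well-defined (that is, the vectors $v_k(x_1),\dots,v_k(x_l)$ span an $l$-dimensional subspace for every $x\in X_l$) and injective, and its image is contained in the open subset of strictly totally positive points of $G_{l,m}$.
   Context: $X_l=\{x=(x_1,\dots,x_l)\in\mathbb{R}^l : 0<x_1<x_2<\dots<x_l\}$ and $K_m=\{k=(k_1,\dots,k_m)\in\mathbb{Z}_{\geq 0}^m : k_1<k_2<\dots<k_m\}$. The modified Bessel functions of the first kind $I_j$, $j\in\mathbb{Z}$, are the Laurent coefficients in $e^{\frac y2\left(z+\frac1z\right)}=\sum_{j=-\infty}^{+\infty}I_j(y)z^j$; equivalently, $I_j(y)=\frac1\pi\int_0^\pi e^{y\cos\phi}\cos(j\phi)\,d\phi$. $G_{l,m}$ is the Grassmannian manifold of $l$-dimensional subspaces of $\mathbb{R}^m$. A point $L\in G_{l,m}$ is represented by an $l\times m$ matrix whose rows form a basis of the subspace $L$; the Plücker coordinates of $L$ are the $l\times l$ minors of this matrix (well-defined up to multiplication by a common nonzero factor). A point $L\in G_{l,m}$ is called strictly totally positive if its Plücker coordinates can be normalized so that all of them are positive, or equivalently, if $L$ can be represented by an $l\times m$ matrix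 all of whose maximal ($l\times l$) minors are positive. *)

theory Defs
  imports "HOL-Analysis.Analysis"
begin

section \<open>Modified Bessel functions of the first kind\<close>

text \<open>
  This is the integral formula for \<open>I\<^sub>j\<close>.  The theorem
  \<open>bessel_I_generating_function\<close> below shows that these numbers are the Laurent
  coefficients in \<open>z\<close> of \<open>exp (y / 2 * (z + 1 / z))\<close>.
\<close>

definition bessel_I :: "int \<Rightarrow> real \<Rightarrow> real" where
  "bessel_I j y = (1 / pi) * integral {0..pi} (\<lambda>\<phi>. exp (y * cos \<phi>) * cos (of_int j * \<phi>))"

lemma has_sum_exp_complex: fixes w :: complex shows "((\<lambda>n. w ^ n / fact n) has_sum exp w) UNIV"
proof (rule norm_summable_imp_has_sum)
  show "summable (\<lambda>n. norm (w ^ n / fact n))"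
    using summable_norm_exp[of w] by (simp add: norm_divide divide_inverse norm_mult norm_power norm_inverse mult.commute)
  show "(\<lambda>n. w ^ n / fact n) sums exp w"
    using exp_converges[of w] by (simp add: scaleR_conv_of_real divide_inverse mult.commute)
qed

lemma abs_summable_exp_product: fixes v w :: complex
  shows "(\<lambda>p. norm (case p of (a,b) \<Rightarrow> v ^ a / fact a * (w ^ b / fact b))) summable_on (UNIV \<times> UNIV)"
proof -
  have s: "(\<lambda>n. norm (u ^ n / fact n)) summable_on UNIV" for u :: complex
    by (rule iffD1[OF summable_on_iff_abs_summable_on_complex has_sum_imp_summable[OF has_sum_exp_complex]])
  show ?thesis
  proof (rule iffD2[OF Infinite_Sum.abs_summable_on_Sigma_iff], intro conjI ballI)
    fix a :: nat
    show "(\<lambda>b. norm (case (a, b) of (a,b) \<Rightarrow> v ^ a / fact a * (w ^ b / fact b))) summable_on UNIV"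
      unfolding split_conv norm_mult by (intro summable_on_cmult_right s)
  next
    show "(\<lambda>a. norm (\<Sum>\<^sub>\<infinity>b. norm (case (a, b) of (a,b) \<Rightarrow> v ^ a / fact a * (w ^ b / fact b)))) summable_on UNIV"
      unfolding split_conv norm_mult infsum_cmult_right' real_norm_def abs_mult abs_norm_cancel
      by (intro summable_on_cmult_left s)
  qed
qed

lemma has_sum_exp_product: fixes v w :: complex
  shows "((\<lambda>(a,b). v ^ a / fact a * (w ^ b / fact b)) has_sum exp (v + w)) (UNIV \<times> UNIV)"
proof (rule has_sum_SigmaI)
  show "((\<lambda>b. case (a, b) of (a,b) \<Rightarrow> v ^ a / fact a * (w ^ b / fact b)) has_sum (v ^ a / fact a * exp w)) UNIV" for a :: nat
    using has_sum_cmult_right[OF has_sum_exp_complex[of w], of "v ^ a / fact a"] by simp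
  show "((\<lambda>a. v ^ a / fact a * exp w) has_sum exp (v + w)) UNIV"
    using has_sum_cmult_left[OF has_sum_exp_complex[of v], of "exp w"] by (simp add: exp_add)
  show "(\<lambda>(a,b). v ^ a / fact a * (w ^ b / fact b)) summable_on (UNIV \<times> UNIV)"
    using abs_summable_exp_product by (rule abs_summable_summable)
qed

definition bessel_series :: "int \<Rightarrow> real \<Rightarrow> real" where
  "bessel_series j u = infsum (\<lambda>n. u ^ (nat (int n + j) + n) / (fact (nat (int n + j)) * fact n)) {n. int n + j \<ge> 0}"

lemma bessel_series_laurent: fixes z :: complex and u :: real assumes z: "z \<noteq> 0"
  shows "((\<lambda>j. of_real (bessel_series j u) * z powi j) has_sum exp (u * (z + 1 / z))) UNIV"
    and "(\<lambda>j. norm (of_real (bessel_series j u) * z powi j)) summable_on UNIV"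
proof -
  define g where "g = (\<lambda>(j::int, n::nat). complex_of_real (u ^ (nat (int n + j) + n) / (fact (nat (int n + j)) * fact n)) * z powi j)"
  let ?S = "Sigma UNIV (\<lambda>j::int. {n::nat. int n + j \<ge> 0})"
  have gs: "(g has_sum exp (u * (z + 1 / z))) ?S"
  proof -
    have "((\<lambda>(a,b). (u * z) ^ a / fact a * ((u / z) ^ b / fact b)) has_sum exp (u * z + u / z)) (UNIV \<times> UNIV)"
      by (rule has_sum_exp_product)
    moreover have "exp (u * z + u / z) = exp (u * (z + 1 / z))" by (simp add: algebra_simps)
    ultimately show ?thesis
    proof (subst has_sum_reindex_bij_witness[where i = "\<lambda>(a,b). (int a - int b, b)" and j = "\<lambda>(j,n). (nat (int n + j), n)"
        and T = "UNIV \<times> UNIV" and h = "\<lambda>(a,b). (u * z) ^ a / fact a * ((u / z) ^ b / fact b)"], goal_cases)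
      case (5 p)
      obtain j n where p: "p = (j, n)" by (cases p)
      with 5 have jn: "int n + j \<ge> 0" by auto
      have "z powi j = z powi (int (nat (int n + j)) - int n)" using jn by simp
      also have "\<dots> = z ^ nat (int n + j) / z ^ n"
        using z by (simp only: power_int_diff power_int_of_nat disj_not1 simp_thms not_False_eq_True)
      finally show ?case unfolding p g_def by (simp add: field_simps power_add power_mult_distrib power_divide z)
    qed auto
  qed
  have inner: "((\<lambda>n. g (j, n)) has_sum (of_real (bessel_series j u) * z powi j)) {n. int n + j \<ge> 0}" for j
  proof -
    have "g summable_on ?S" using gs has_sum_imp_summable by blast
    hence "(\<lambda>n. g (j, n)) summable_on {n. int n + j \<ge> 0}"
      using summable_on_Sigma_banach summable_on_SigmaD1[of "\<lambda>x y. g (x,y)" UNIV "\<lambda>j. {n. int n + j \<ge> 0}" j] by simp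
    hence "(\<lambda>n. (complex_of_real (u ^ (nat (int n + j) + n) / (fact (nat (int n + j)) * fact n)) * z powi j) * (1 / z powi j)) summable_on {n. int n + j \<ge> 0}"
      unfolding g_def split_conv by (rule summable_on_cmult_left)
    hence "(\<lambda>n. complex_of_real (u ^ (nat (int n + j) + n) / (fact (nat (int n + j)) * fact n))) summable_on {n. int n + j \<ge> 0}"
      by (rule back_subst[where P = "\<lambda>f. f summable_on _"]) (use z in auto)
    from summable_on_Re[OF this]
    have "(\<lambda>n. (u ^ (nat (int n + j) + n) / (fact (nat (int n + j)) * fact n))) summable_on {n. int n + j \<ge> 0}"
      by (simp only: Re_complex_of_real)
    hence "((\<lambda>n. (u ^ (nat (int n + j) + n) / (fact (nat (int n + j)) * fact n))) has_sum bessel_series j u) {n. int n + j \<ge> 0}"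
      unfolding bessel_series_def by (rule has_sum_infsum)
    from has_sum_cmult_left[OF has_sum_of_real[OF this, where ?'a = complex], of "z powi j"]
    show ?thesis unfolding g_def by simp
  qed
  show *: "((\<lambda>j. of_real (bessel_series j u) * z powi j) has_sum exp (u * (z + 1 / z))) UNIV"
    by (rule has_sum_SigmaD[OF gs]) (rule inner)
  show "(\<lambda>j. norm (of_real (bessel_series j u) * z powi j)) summable_on UNIV"
    by (rule iffD1[OF summable_on_iff_abs_summable_on_complex has_sum_imp_summable[OF *]])
qed

lemma bessel_series_minus: "bessel_series (-j) u = bessel_series j u"
  unfolding bessel_series_def
  by (rule infsum_reindex_bij_witness[where i = "\<lambda>n. nat (int n + j)" and j = "\<lambda>n. nat (int n - j)"])
    (auto simp: add_ac mult_ac)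

lemma has_integral_cos_times_cos: "((\<lambda>x. cos (of_int j * x) * cos (of_int k * x)) has_integral
   (if j = k then pi/2 else 0) + (if j = -k then pi/2 else 0)) {0..pi}"
proof -
  have *: "((\<lambda>x. cos (of_int n * x)) has_integral (if n = 0 then pi else 0)) {0..pi}" for n :: int
  proof (cases "n = 0")
    case True then show ?thesis using has_integral_const_real[of "1::real" 0 pi] by simp
  next
    case False
    have "((\<lambda>x. cos (of_int n * x)) has_integral (sin (of_int n * pi) / n - sin (of_int n * 0) / n)) {0..pi}"
      by (rule fundamental_theorem_of_calculus) (use False in \<open>auto intro!: derivative_eq_intros simp: has_real_derivative_iff_has_vector_derivative[symmetric]\<close>)
    then show ?thesis using False by (simp add: sin_int_times_real mult.commute)
  qed
  have "((\<lambda>x. (cos (of_int (j - k) * x) + cos (of_int (j + k) * x)) / 2) has_integral ((if j - k = 0 then pi else 0) + (if j + k = 0 then pi else 0))/2) {0..pi}"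
    by (intro has_integral_divide has_integral_add *)
  moreover have "(cos (of_int (j - k) * x) + cos (of_int (j + k) * x)) / 2 = cos (of_int j * x) * cos (of_int k * x)" for x :: real
    by (simp add: algebra_simps cos_add cos_diff)
  moreover have "((if j - k = 0 then pi else 0) + (if j + k = 0 then pi else 0))/2 = (if j = k then pi/2 else 0) + (if j = -k then pi/2 else 0)"
    by auto
  ultimately show ?thesis by (simp only:)
qed

lemma bessel_series_cos:
  "((\<lambda>j. bessel_series j u * cos (of_int j * x)) has_sum exp (2 * u * cos x)) UNIV"
proof -
  have c: "cis x + 1 / cis x = of_real (2 * cos x)"
    by (simp add: complex_eq_iff flip: cis_inverse divide_inverse  inverse_eq_divide)
  have r: "Re (of_real (bessel_series j u) * cis x powi j) = bessel_series j u * cos (of_int j * x)" for j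
    by (simp add: cis_power_int)
  have "Re (exp (of_real u * (cis x + 1 / cis x))) = exp (2 * u * cos x)"
    unfolding c by (simp flip: of_real_mult add: exp_of_real mult_ac)
  then show ?thesis using has_sum_Re[OF bessel_series_laurent(1)[of "cis x" u]] by (simp only: r) simp
qed

lemma bessel_I_eq_series: "bessel_I k y = bessel_series k (y/2)"
proof -
  let ?u = "y/2"
  have abs: "(\<lambda>j. \<bar>bessel_series j ?u\<bar>) summable_on UNIV"
    using bessel_series_laurent(2)[of 1 ?u] by simp
  have "uniform_limit {0..pi} (\<lambda>X x. \<Sum>j\<in>X. bessel_series j ?u * cos (of_int j * x) * cos (of_int k * x))
     (\<lambda>x. \<Sum>\<^sub>\<infinity>j\<in>UNIV. bessel_series j ?u * cos (of_int j * x) * cos (of_int k * x)) (finite_subsets_at_top UNIV)"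
    by (rule Weierstrass_m_test_general[OF _ abs])
      (auto simp: abs_mult mult.assoc intro!: mult_left_le mult_le_one)
  moreover have "(\<Sum>\<^sub>\<infinity>j\<in>UNIV. bessel_series j ?u * cos (of_int j * x) * cos (of_int k * x)) = exp (y * cos x) * cos (of_int k * x)" for x
    using has_sum_cmult_left[OF bessel_series_cos[of ?u x], of "cos (of_int k * x)"] by (simp add: infsumI)
  ultimately have U: "uniform_limit {0..pi} (\<lambda>X x. \<Sum>j\<in>X. bessel_series j ?u * cos (of_int j * x) * cos (of_int k * x))
     (\<lambda>x. exp (y * cos x) * cos (of_int k * x)) (finite_subsets_at_top UNIV)" by simp
  obtain I J where I: "\<And>X. ((\<lambda>x. \<Sum>j\<in>X. bessel_series j ?u * cos (of_int j * x) * cos (of_int k * x)) has_integral I X) {0..pi}"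
    and J: "((\<lambda>x. exp (y * cos x) * cos (of_int k * x)) has_integral J) {0..pi}"
    and lim: "(I \<longlongrightarrow> J) (finite_subsets_at_top UNIV)"
    by (rule uniform_limit_integral[OF U]) (auto intro!: continuous_intros)
  have Iv: "I X = pi * bessel_series k ?u" if X: "finite X" "{k,-k} \<subseteq> X" for X
  proof -
    have "((\<lambda>x. \<Sum>j\<in>X. bessel_series j ?u * (cos (of_int j * x) * cos (of_int k * x))) has_integral
       (\<Sum>j\<in>X. bessel_series j ?u * ((if j = k then pi/2 else 0) + (if j = -k then pi/2 else 0)))) {0..pi}"
      by (intro has_integral_sum X has_integral_mult_right has_integral_cos_times_cos)
    hence "I X = (\<Sum>j\<in>X. bessel_series j ?u * ((if j = k then pi/2 else 0) + (if j = -k then pi/2 else 0)))"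
      using I[of X] by (auto simp: mult.assoc intro: has_integral_unique)
    also have "\<dots> = (\<Sum>j\<in>X. (if j = k then bessel_series j ?u * (pi/2) else 0)) + (\<Sum>j\<in>X. (if j = -k then bessel_series j ?u * (pi/2) else 0))"
      unfolding sum.distrib[symmetric] by (intro sum.cong) (auto simp: algebra_simps)
    also have "\<dots> = pi * bessel_series k ?u" using X by (simp add: bessel_series_minus)
    finally show ?thesis .
  qed
  have "eventually (\<lambda>X. I X = pi * bessel_series k ?u) (finite_subsets_at_top UNIV)"
    unfolding eventually_finite_subsets_at_top by (rule exI[of _ "{k,-k}"]) (use Iv in auto)
  hence "(I \<longlongrightarrow> pi * bessel_series k ?u) (finite_subsets_at_top UNIV)" by (rule tendsto_eventually)
  hence "J = pi * bessel_series k ?u" using lim by (intro tendsto_unique) auto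
  thus ?thesis unfolding bessel_I_def using integral_unique[OF J] by simp
qed

theorem bessel_I_generating_function: fixes z :: complex assumes "z \<noteq> 0"
  shows "((\<lambda>j. of_real (bessel_I j y) * z powi j) has_sum exp (of_real y / 2 * (z + 1 / z))) UNIV"
  using bessel_series_laurent(1)[OF assms, of "y/2"] by (simp add: bessel_I_eq_series)

section \<open>Parameter sets\<close>

text \<open>
  The index sets \<open>{1..l}\<close> and \<open>{1..m}\<close> are rendered by finite linearly ordered
  types \<open>'l\<close> and \<open>'m\<close>, so that \<open>l = CARD('l)\<close> and \<open>m = CARD('m)\<close>.
\<close>

definition X_set :: "(real ^ 'l::{finite,linorder}) set" where
  "X_set = {x. (\<forall>i. 0 < x $ i) \<and> (\<forall>i j. i < j \<longrightarrow> x $ i < x $ j)}"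

definition K_set :: "(int ^ 'm::{finite,linorder}) set" where
  "K_set = {k. (\<forall>j. 0 \<le> k $ j) \<and> (\<forall>i j. i < j \<longrightarrow> k $ i < k $ j)}"

section \<open>Grassmannians and Pluecker coordinates\<close>

definition grassmannian :: "'l::finite itself \<Rightarrow> (real ^ 'm::finite) set set" where
  "grassmannian _ = {L. subspace L \<and> dim L = CARD('l)}"

text \<open>
  \<^const>\<open>rows\<close> is a set, so linear independence of the family of rows
  needs the injectivity clause as well.
\<close>

definition rows_basis_of :: "real ^ 'm::finite ^ 'l::finite \<Rightarrow> (real ^ 'm) set \<Rightarrow> bool" where
  "rows_basis_of A L \<longleftrightarrow> inj (\<lambda>i. row i A) \<and> independent (rows A) \<and> span (rows A) = L"

text \<open>
  The \<open>l \<times> l\<close> minors of an \<open>l \<times> m\<close> matrix are indexed by the increasing selections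
  of \<open>l\<close> column indices.
\<close>

definition pluecker :: "real ^ 'm::{finite,linorder} ^ 'l::{finite,linorder} \<Rightarrow> ('l \<Rightarrow> 'm) \<Rightarrow> real" where
  "pluecker A J = det (\<chi> i j. A $ i $ J j)"

definition strictly_totally_positive ::
  "'l::{finite,linorder} itself \<Rightarrow> (real ^ 'm::{finite,linorder}) set set" where
  "strictly_totally_positive _ =
     {L \<in> grassmannian TYPE('l).
        \<exists>(A :: real ^ 'm::{finite,linorder} ^ 'l::{finite,linorder}) c. rows_basis_of A L \<and> c \<noteq> 0 \<and>
          (\<forall>J. strict_mono J \<longrightarrow> c * pluecker A J > 0)}"

subsection \<open>Topology of the Grassmannian\<close>

text \<open>
  The quotient topology of the space of matrices of full rank with respect to the map
  that sends a matrix to its row space.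
\<close>

definition frames :: "(real ^ 'm::finite ^ 'l::finite) set" where
  "frames = {A. rows_basis_of A (span (rows A))}"

definition grassmannian_topology :: "'l::finite itself \<Rightarrow> (real ^ 'm::finite) set topology" where
  "grassmannian_topology _ = topology (\<lambda>U. U \<subseteq> grassmannian TYPE('l) \<and>
     openin (top_of_set (frames :: (real ^ 'm ^ 'l) set)) {A \<in> frames. span (rows A) \<in> U})"

lemma istopology_grassmannian:
  "istopology (\<lambda>U :: (real ^ 'm::finite) set set. U \<subseteq> grassmannian TYPE('l::finite) \<and>
     openin (top_of_set (frames :: (real ^ 'm ^ 'l) set)) {A \<in> frames. span (rows A) \<in> U})"
  unfolding istopology_def
proof (intro conjI allI impI)
  let ?P = "\<lambda>U. openin (top_of_set (frames :: (real ^ 'm ^ 'l) set)) {A \<in> frames. span (rows A) \<in> U}"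
  fix S T :: "(real ^ 'm) set set"
  assume a: "S \<subseteq> grassmannian TYPE('l) \<and> ?P S" "T \<subseteq> grassmannian TYPE('l) \<and> ?P T"
  have eq: "{A \<in> frames. span (rows (A :: real ^ 'm ^ 'l)) \<in> S \<inter> T} =
      {A \<in> frames. span (rows A) \<in> S} \<inter> {A \<in> frames. span (rows A) \<in> T}" by blast
  show "?P (S \<inter> T)" unfolding eq by (rule openin_Int) (use a in blast)+
  show "S \<inter> T \<subseteq> grassmannian TYPE('l)" using a by blast
next
  let ?P = "\<lambda>U. openin (top_of_set (frames :: (real ^ 'm ^ 'l) set)) {A \<in> frames. span (rows A) \<in> U}"
  fix K :: "(real ^ 'm) set set set"
  assume a: "\<forall>U\<in>K. U \<subseteq> grassmannian TYPE('l) \<and> ?P U"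
  have eq: "{A \<in> frames. span (rows (A :: real ^ 'm ^ 'l)) \<in> \<Union>K} =
      (\<Union>U\<in>K. {A \<in> frames. span (rows A) \<in> U})" by blast
  show "?P (\<Union>K)" unfolding eq by (rule openin_Union) (use a in blast)
  show "\<Union>K \<subseteq> grassmannian TYPE('l)" using a by blast
qed

lemma frames_image: "(\<lambda>A :: real ^ 'm::finite ^ 'l::finite. span (rows A)) ` frames = grassmannian TYPE('l)"
proof (intro equalityI subsetI)
  fix L :: "(real ^ 'm) set" assume "L \<in> (\<lambda>A :: real ^ 'm ^ 'l. span (rows A)) ` frames"
  then obtain A :: "real ^ 'm ^ 'l" where A: "A \<in> frames" "L = span (rows A)" by blast
  have "rows A = range (\<lambda>i. row i A)" by (auto simp: rows_def)
  hence "card (rows A) = CARD('l)" using A by (simp add: frames_def rows_basis_of_def card_image)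
  with A show "L \<in> grassmannian TYPE('l)"
    by (simp add: grassmannian_def frames_def rows_basis_of_def dim_eq_card_independent)
next
  fix L :: "(real ^ 'm) set" assume L: "L \<in> grassmannian TYPE('l)"
  obtain B where B: "B \<subseteq> L" "independent B" "L \<subseteq> span B" "card B = dim L"
    by (rule basis_exists)
  have "finite B" using B independent_imp_finite by blast
  moreover have "card B = CARD('l)" using B L by (simp add: grassmannian_def)
  ultimately obtain f where f: "bij_betw f (UNIV :: 'l set) B"
    using finite_same_card_bij[of "UNIV :: 'l set" B] by auto
  define A :: "real ^ 'm ^ 'l" where "A = (\<chi> i. f i)"
  have r: "row i A = f i" for i by (simp add: A_def row_def vec_eq_iff)
  have rows: "rows A = B" using f by (auto simp: rows_def r bij_betw_def)
  have "span (rows A) = L" using B L rows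
    by (metis (no_types, lifting) grassmannian_def mem_Collect_eq span_minimal subset_antisym)
  moreover have "A \<in> frames"
    using f B by (simp add: frames_def rows_basis_of_def rows r bij_betw_def)
  ultimately show "L \<in> (\<lambda>A :: real ^ 'm ^ 'l. span (rows A)) ` frames" by blast
qed

lemma openin_grassmannian_topology:
  "openin (grassmannian_topology TYPE('l::finite)) (U :: (real ^ 'm::finite) set set) \<longleftrightarrow>
     U \<subseteq> grassmannian TYPE('l) \<and>
     openin (top_of_set (frames :: (real ^ 'm ^ 'l) set)) {A \<in> frames. span (rows A) \<in> U}"
  unfolding grassmannian_topology_def
  by (subst topology_inverse'[OF istopology_grassmannian]) (rule refl)

lemma topspace_grassmannian_topology:
  "topspace (grassmannian_topology TYPE('l::finite)) = (grassmannian TYPE('l) :: (real ^ 'm::finite) set set)"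
proof (rule antisym)
  show "topspace (grassmannian_topology TYPE('l)) \<subseteq> (grassmannian TYPE('l) :: (real ^ 'm) set set)"
    using openin_topspace[of "grassmannian_topology TYPE('l)"] openin_grassmannian_topology by blast
  have "{A \<in> frames. span (rows (A :: real ^ 'm ^ 'l)) \<in> grassmannian TYPE('l)} = frames"
    using frames_image by blast
  hence "openin (grassmannian_topology TYPE('l)) (grassmannian TYPE('l) :: (real ^ 'm) set set)"
    by (simp add: openin_grassmannian_topology)
  thus "(grassmannian TYPE('l) :: (real ^ 'm) set set) \<subseteq> topspace (grassmannian_topology TYPE('l))"
    by (rule openin_subset)
qed

lemma quotient_map_row_space:
  "quotient_map (top_of_set frames) (grassmannian_topology TYPE('l::finite))
     (\<lambda>A :: real ^ 'm::finite ^ 'l. span (rows A))"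
  by (auto simp: quotient_map_def topspace_grassmannian_topology openin_grassmannian_topology frames_image)

section \<open>The mapping \<open>H\<^sub>k\<close>\<close>

definition v_vec :: "int ^ 'm::finite \<Rightarrow> real \<Rightarrow> real ^ 'm" where
  "v_vec k y = (\<chi> j. bessel_I (k $ j) y)"

definition H_map :: "int ^ 'm::finite \<Rightarrow> real ^ 'l::finite \<Rightarrow> (real ^ 'm) set" where
  "H_map k x = span (range (\<lambda>i. v_vec k (x $ i)))"

end

theory Submission
  imports Defs
begin

text \<open>
  Integrating the power series of \<open>exp (x (1 + cos \<phi>))\<close> gives
  \<open>exp x * I\<^sub>k(x) = (\<Sum>N. (x/2)^N / N! * B(N,k))\<close> with \<open>B(N,k) = (2N choose N + k)\<close>.
  The array \<open>B\<close> satisfies \<open>B(N+1,k) = B(N,k-1) + 2 B(N,k) + B(N,k+1)\<close>, and by the symmetry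
  \<open>B(N,-1) = B(N,1)\<close> it is a product of nonnegative unit lower bidiagonal matrices.
  Multiplication by such a matrix never decreases a minor if all minors are nonnegative, so the
  minors of \<open>exp (x\<^sub>i) * I\<^sub>k(x\<^sub>i)\<close> are at least those of the generalized Vandermonde matrix
  \<open>(x\<^sub>i/2)^N / N!\<close>, which are positive.  Hence all minors of the Bessel matrix are
  positive.  If \<open>H\<^sub>k(x) = H\<^sub>k(y)\<close> for \<open>x \<noteq> y\<close>, then some \<open>y\<^sub>i\<close> is not a coordinate of
  \<open>x\<close>, and the \<open>l + 1 \<le> m\<close> vectors at the \<open>x\<^sub>j\<close> and \<open>y\<^sub>i\<close> would be dependent.
\<close>

section \<open>Bidiagonal column operations and Bessel series\<close>

text \<open>The selected columns of \<open>a\<close> form the rows of this matrix, so the row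
  multilinearity of \<open>det\<close> acts on columns of \<open>a\<close>.\<close>

definition col_minor :: "('l::finite \<Rightarrow> nat \<Rightarrow> real) \<Rightarrow> ('l \<Rightarrow> nat) \<Rightarrow> real" where
  "col_minor a k = det (\<chi> j i. a i (k j))"

text \<open>
  Expanding the new columns one at a time turns the minor into a nonnegative combination of
  minors whose column indices are \<open>k j\<close> or \<open>k j + 1\<close>.  Such indices are still weakly
  increasing, so each term is nonnegative or has two equal columns.
\<close>

lemma col_minor_bidiagonal:
  fixes a :: "'l::{finite,linorder} \<Rightarrow> nat \<Rightarrow> real"
  assumes nonneg: "\<And>k. strict_mono k \<Longrightarrow> 0 \<le> col_minor a k"
    and m: "\<And>n. 0 \<le> m n" and k: "strict_mono k"
  shows "col_minor a k \<le> col_minor (\<lambda>i n. a i n + m n * a i (Suc n)) k"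
proof -
  define a' where "a' = (\<lambda>i n. a i n + m n * a i (Suc n))"
  \<comment> \<open>In \<open>D S h\<close> the columns in \<open>S\<close> are already the new ones
    at \<open>k\<close>; the others are old columns at the positions \<open>h\<close>. The values of
    \<open>h\<close> on \<open>S\<close> do not matter.\<close>
  define D where "D = (\<lambda>S h. det (\<chi> j. if j \<in> S then (\<chi> i. a' i (k j)) else (\<chi> i. a i (h j))))"
  define T where "T = (\<lambda>h. \<forall>j. h j = k j \<or> h j = Suc (k j))"
  have base: "0 \<le> D {} h" if "T h" for h
  proof (cases "inj h")
    case True
    have "h i < h j" if "i < j" for i j
    proof -
      have "k i < k j" using k that by (simp add: strict_mono_def)
      hence "h i \<le> h j" using \<open>T h\<close> unfolding T_def by (metis Suc_leI le_SucI less_imp_le_nat not_less_eq_eq)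
      moreover have "h i \<noteq> h j" using True that by (auto dest: injD)
      ultimately show ?thesis by simp
    qed
    hence "strict_mono h" by (rule strict_monoI)
    from nonneg[OF this] show ?thesis by (simp add: D_def col_minor_def)
  next
    case False
    then obtain i j where "i \<noteq> j" "h i = h j" by (auto simp: inj_def)
    hence "D {} h = 0" unfolding D_def by (intro det_identical_rows[of i j]) (auto simp: row_def)
    thus ?thesis by simp
  qed
  have step: "D (insert s S) h = D S (h(s := k s)) + m (k s) * D S (h(s := Suc (k s)))"
    if "s \<notin> S" for s S h
  proof -
    let ?c = "\<lambda>j. if j \<in> S then (\<chi> i. a' i (k j)) else (\<chi> i. a i (h j))"
    have "D (insert s S) h = det (\<chi> j. if j = s
        then (\<chi> i. a i (k j)) + m (k s) *s (\<chi> i. a i (Suc (k j))) else ?c j)"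
      unfolding D_def by (intro arg_cong[where f = det]) (auto simp: vec_eq_iff a'_def)
    also have "\<dots> = det (\<chi> j. if j = s then (\<chi> i. a i (k j)) else ?c j)
        + m (k s) * det (\<chi> j. if j = s then (\<chi> i. a i (Suc (k j))) else ?c j)"
      by (simp only: det_row_add det_row_mul)
    also have "(\<chi> j. if j = s then (\<chi> i. a i (k j)) else ?c j)
        = (\<chi> j. if j \<in> S then (\<chi> i. a' i (k j)) else (\<chi> i. a i ((h(s := k s)) j)))"
      using that by (auto simp: vec_eq_iff)
    also have "(\<chi> j. if j = s then (\<chi> i. a i (Suc (k j))) else ?c j)
        = (\<chi> j. if j \<in> S then (\<chi> i. a' i (k j)) else (\<chi> i. a i ((h(s := Suc (k s))) j)))"
      using that by (auto simp: vec_eq_iff)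
    finally show ?thesis by (simp add: D_def)
  qed
  have "finite (UNIV :: 'l set)" by simp
  hence "(\<forall>h. T h \<longrightarrow> 0 \<le> D UNIV h) \<and> D {} k \<le> D UNIV k"
  proof (induction rule: finite_induct)
    case empty
    show ?case using base by simp
  next
    case (insert s S)
    have pos: "0 \<le> m (k s) * D S (h(s := Suc (k s)))" if "T h" for h
      using insert.IH m that by (auto simp: T_def)
    have "0 \<le> D (insert s S) h" if "T h" for h
      using insert.IH pos[OF that] that step[OF insert.hyps(2), of h] by (auto simp: T_def)
    \<comment> \<open>For \<open>h = k\<close> the first term of \<open>step\<close> is
      \<open>D S k\<close> itself, because \<open>k(s := k s) = k\<close>; the second term is
      nonnegative.\<close>
    moreover have "D S k \<le> D (insert s S) k"
      using step[OF insert.hyps(2), of k] pos[of k] by (simp add: T_def)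
    ultimately show ?case using insert.IH by auto
  qed
  thus ?thesis by (simp add: D_def col_minor_def a'_def)
qed

section \<open>Trigonometric moments and the power series of
  \<open>exp x * bessel_I k x\<close>\<close>

text \<open>These numbers are the binomial coefficients \<open>2N choose N + |k|\<close>.\<close>

definition moment :: "nat \<Rightarrow> int \<Rightarrow> real" where
  "moment N k = 2 ^ N / pi * integral {0..pi} (\<lambda>\<phi>. (1 + cos \<phi>) ^ N * cos (of_int k * \<phi>))"

lemma moment_minus [simp]: "moment N (- k) = moment N k"
  by (simp add: moment_def)

lemma moment_0: "moment 0 k = of_bool (k = 0)"
  using has_integral_cos_times_cos[of 0 k] by (auto simp: moment_def dest!: integral_unique)

text \<open>One factor \<open>1 + cos \<phi>\<close> is split off, and
  \<open>2 * cos \<phi> * cos (k * \<phi>)\<close> is the sum of the cosines of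
  \<open>(k + 1) * \<phi>\<close> and \<open>(k - 1) * \<phi>\<close>.\<close>

lemma moment_Suc: "moment (Suc N) k = 2 * moment N k + moment N (k + 1) + moment N (k - 1)"
proof -
  define f :: "int \<Rightarrow> real \<Rightarrow> real" where "f = (\<lambda>j \<phi>. (1 + cos \<phi>) ^ N * cos (of_int j * \<phi>))"
  have f: "(f j has_integral integral {0..pi} (f j)) {0..pi}" for j
    unfolding f_def by (intro integrable_integral integrable_continuous_interval continuous_intros)
  have "((\<lambda>\<phi>. f k \<phi> + (f (k + 1) \<phi> + f (k - 1) \<phi>) / 2) has_integral
      integral {0..pi} (f k) + (integral {0..pi} (f (k + 1)) + integral {0..pi} (f (k - 1))) / 2) {0..pi}"
    by (intro has_integral_add has_integral_divide f)
  moreover have "f k \<phi> + (f (k + 1) \<phi> + f (k - 1) \<phi>) / 2 = (1 + cos \<phi>) ^ Suc N * cos (of_int k * \<phi>)" for \<phi>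
    by (simp add: f_def algebra_simps cos_add cos_diff)
  ultimately have "integral {0..pi} (\<lambda>\<phi>. (1 + cos \<phi>) ^ Suc N * cos (of_int k * \<phi>)) =
      integral {0..pi} (f k) + (integral {0..pi} (f (k + 1)) + integral {0..pi} (f (k - 1))) / 2"
    by (simp add: integral_unique)
  hence "moment (Suc N) k = 2 ^ Suc N / pi *
      (integral {0..pi} (f k) + (integral {0..pi} (f (k + 1)) + integral {0..pi} (f (k - 1))) / 2)"
    by (simp only: moment_def)
  thus ?thesis by (simp only: moment_def f_def) (simp add: field_simps)
qed

text \<open>The function \<open>exp (x * (1 + cos \<phi>)) = exp x * exp (x * cos \<phi>)\<close> is
  expanded in powers of \<open>1 + cos \<phi>\<close> and integrated term by term against
  \<open>cos (k * \<phi>)\<close>. The bound \<open>\<bar>1 + cos \<phi>\<bar> \<le> 2\<close>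
  yields uniform convergence.\<close>

lemma moment_sums: "(\<lambda>N. (x / 2) ^ N / fact N * moment N k) sums (exp x * bessel_I k x)"
proof -
  let ?f = "\<lambda>N \<phi>. x ^ N / fact N * ((1 + cos \<phi>) ^ N * cos (of_int k * \<phi>))"
  have summ: "summable (\<lambda>N. (2 * \<bar>x\<bar>) ^ N / fact N)"
    using summable_exp[of "2 * \<bar>x\<bar>"] by (simp add: field_simps)
  have "uniform_limit {0..pi} (\<lambda>n \<phi>. \<Sum>N<n. ?f N \<phi>) (\<lambda>\<phi>. \<Sum>N. ?f N \<phi>) sequentially"
  proof (rule Weierstrass_m_test[OF _ summ])
    fix N :: nat and \<phi> :: real assume "\<phi> \<in> {0..pi}"
    have "\<bar>1 + cos \<phi>\<bar> \<le> 2" using cos_ge_minus_one[of \<phi>] cos_le_one[of \<phi>] by linarith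
    hence "\<bar>1 + cos \<phi>\<bar> ^ N \<le> 2 ^ N" by (intro power_mono) auto
    hence "\<bar>1 + cos \<phi>\<bar> ^ N * \<bar>cos (of_int k * \<phi>)\<bar> \<le> 2 ^ N * 1" by (intro mult_mono) auto
    hence "\<bar>x\<bar> ^ N / fact N * (\<bar>1 + cos \<phi>\<bar> ^ N * \<bar>cos (of_int k * \<phi>)\<bar>) \<le> \<bar>x\<bar> ^ N / fact N * 2 ^ N"
      by (intro mult_left_mono) auto
    thus "norm (?f N \<phi>) \<le> (2 * \<bar>x\<bar>) ^ N / fact N"
      by (simp add: abs_mult power_abs power_mult_distrib mult_ac)
  qed
  moreover have "(\<Sum>N. ?f N \<phi>) = exp x * (exp (x * cos \<phi>) * cos (of_int k * \<phi>))" for \<phi>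
  proof -
    have "(\<lambda>N. (x * (1 + cos \<phi>)) ^ N / fact N * cos (of_int k * \<phi>)) sums
        (exp (x * (1 + cos \<phi>)) * cos (of_int k * \<phi>))"
      by (intro sums_mult2) (use exp_converges[of "x * (1 + cos \<phi>)"] in \<open>simp add: field_simps\<close>)
    hence "(\<lambda>N. ?f N \<phi>) sums (exp (x * (1 + cos \<phi>)) * cos (of_int k * \<phi>))"
      by (simp add: power_mult_distrib mult_ac)
    thus ?thesis by (simp add: sums_unique[symmetric] algebra_simps exp_add)
  qed
  ultimately have U: "uniform_limit {0..pi} (\<lambda>n \<phi>. \<Sum>N<n. ?f N \<phi>)
      (\<lambda>\<phi>. exp x * (exp (x * cos \<phi>) * cos (of_int k * \<phi>))) sequentially" by simp
  obtain I J where I: "\<And>n. ((\<lambda>\<phi>. \<Sum>N<n. ?f N \<phi>) has_integral I n) {0..pi}"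
    and J: "((\<lambda>\<phi>. exp x * (exp (x * cos \<phi>) * cos (of_int k * \<phi>))) has_integral J) {0..pi}"
    and lim: "I \<longlonglongrightarrow> J"
    by (rule uniform_limit_integral[OF U]) (auto intro!: continuous_intros)
  have "((\<lambda>\<phi>. \<Sum>N<n. ?f N \<phi>) has_integral
      (\<Sum>N<n. x ^ N / fact N * integral {0..pi} (\<lambda>\<phi>. (1 + cos \<phi>) ^ N * cos (of_int k * \<phi>)))) {0..pi}" for n
    by (intro has_integral_sum has_integral_mult_right integrable_integral
        integrable_continuous_interval continuous_intros) auto
  with I have "I n = (\<Sum>N<n. x ^ N / fact N * integral {0..pi} (\<lambda>\<phi>. (1 + cos \<phi>) ^ N * cos (of_int k * \<phi>)))" for n
    by (rule has_integral_unique)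
  \<comment> \<open>The factor \<open>2 ^ N / pi\<close> in \<open>moment\<close> turns
    \<open>x ^ N\<close> into \<open>(x / 2) ^ N\<close> and leaves the \<open>pi\<close> that
    cancels against the one in \<open>bessel_I\<close>.\<close>
  hence "I n = pi * (\<Sum>N<n. (x / 2) ^ N / fact N * moment N k)" for n
    by (simp add: moment_def sum_distrib_left power_divide)
  moreover have "J = pi * (exp x * bessel_I k x)"
    using integral_unique[OF J] by (simp add: bessel_I_def)
  ultimately have "(\<lambda>n. pi * (\<Sum>N<n. (x / 2) ^ N / fact N * moment N k)) \<longlonglongrightarrow> pi * (exp x * bessel_I k x)"
    using lim by (metis (no_types, lifting) ext)
  from tendsto_divide[OF this tendsto_const[of pi]]
  have "(\<lambda>n. \<Sum>N<n. (x / 2) ^ N / fact N * moment N k) \<longlonglongrightarrow> exp x * bessel_I k x"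
    by simp
  thus ?thesis by (simp add: sums_def)
qed

text \<open>
  One step of the recursion for \<^const>\<open>moment\<close> on the columns from \<open>r\<close> on is a product of two
  unit bidiagonal column operations.  The array \<open>c r\<close> is what the steps \<open>M - 1\<close>, \<open>M - 2\<close>,
  \<dots>, \<open>r\<close> make of \<open>w\<close> with the columns beyond \<open>M\<close> set to zero.
\<close>

lemma col_minor_le_moment_sum:
  fixes w :: "'l::{finite,linorder} \<Rightarrow> nat \<Rightarrow> real"
  assumes pos: "\<And>k. strict_mono k \<Longrightarrow> 0 \<le> col_minor w k"
    and k: "strict_mono k" and kM: "\<And>j. k j \<le> M"
  shows "col_minor w k \<le> col_minor (\<lambda>i n. \<Sum>N\<le>M. w i N * moment N (int n)) k"
proof -
  define c where "c = (\<lambda>r i n. if n < r then w i n else \<Sum>N=r..M. w i N * moment (N - r) (int (n - r)))"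
  \<comment> \<open>At \<open>r = M\<close> each column from \<open>M\<close> on is a sum with the
    single term \<open>N = M\<close>, whose weight \<open>moment 0\<close> is 1 in column
    \<open>M\<close> and 0 beyond.\<close>
  have c_M: "c M i n = (if n \<le> M then w i n else 0)" for i n
    by (cases n M rule: linorder_cases) (simp_all add: c_def moment_0)
  have nonneg_M: "0 \<le> col_minor (c M) h" if h: "strict_mono h" for h
  proof (cases "\<forall>j. h j \<le> M")
    case True
    hence "col_minor (c M) h = col_minor w h"
      unfolding col_minor_def by (intro arg_cong[where f = det])
        (auto simp: c_M vec_eq_iff)
    thus ?thesis using pos[OF h] by simp
  next
    case False
    then obtain j where "h j > M" by (auto simp: not_le)
    hence "col_minor (c M) h = 0"
      unfolding col_minor_def
      by (intro det_zero_row(1)[of j]) (auto simp: c_M row_def vec_eq_iff)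
    thus ?thesis by simp
  qed
  have M_eq: "col_minor (c M) k = col_minor w k"
    unfolding col_minor_def using kM by (intro arg_cong[where f = det])
      (auto simp: c_M vec_eq_iff)
  \<comment> \<open>Write C(n) for column \<open>n\<close> of \<open>c (Suc r)\<close>, which for
    \<open>n > r\<close> holds moments at \<open>n - Suc r\<close>. For \<open>n > r\<close> the
    recursion gives C(n) + 2 C(n+1) + C(n+2), that is, the right neighbour is added twice in
    succession. At \<open>n = r\<close> the symmetry of \<open>moment\<close> gives C(r) + 2 C(r+1)
    + 2 C(r+2), hence the 2 in \<open>m\<close> and no first addition there.\<close>
  have c_step: "c r i n = t i n + m n * t i (Suc n)"
    if "r < M" "t = (\<lambda>i n. c (Suc r) i n + of_bool (n > r) * c (Suc r) i (Suc n))"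
      "m = (\<lambda>n. if n < r then 0 else if n = r then 2 else 1)" for r i n t m
  proof -
    have split: "(\<Sum>N=r..M. f N) = f r + (\<Sum>N=Suc r..M. f N)" for f :: "nat \<Rightarrow> real"
      using \<open>r < M\<close> by (simp add: sum.atLeast_Suc_atMost)
    have mom: "moment (N - r) j = 2 * moment (N - Suc r) j + moment (N - Suc r) (j + 1) + moment (N - Suc r) (j - 1)"
      if "N \<in> {Suc r..M}" for N j
      using that moment_Suc[of "N - Suc r" j] by (simp add: Suc_diff_Suc)
    consider "n < r" | "n = r" | q where "n = r + Suc q" by (metis less_imp_Suc_add linorder_neqE_nat add_Suc_right)
    thus ?thesis
    proof cases
      case 1
      thus ?thesis by (simp add: that c_def)
    next
      case 2
      have "moment N (- 1) = moment N 1" for N using moment_minus[of N 1] by simp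
      hence "(\<Sum>N=Suc r..M. w i N * moment (N - r) 0) =
          (\<Sum>N=Suc r..M. w i N * (2 * moment (N - Suc r) 0 + 2 * moment (N - Suc r) 1))"
        by (intro sum.cong) (simp_all add: mom)
      hence "c r i n = w i r + (\<Sum>N=Suc r..M. w i N * (2 * moment (N - Suc r) 0 + 2 * moment (N - Suc r) 1))"
        using 2 by (simp add: c_def split moment_0)
      thus ?thesis using 2
        by (simp add: that c_def sum_distrib_left sum.distrib algebra_simps)
    next
      case (3 q)
      have "(\<Sum>N=Suc r..M. w i N * moment (N - r) (int q + 1)) =
          (\<Sum>N=Suc r..M. w i N * (2 * moment (N - Suc r) (int q + 1)
          + moment (N - Suc r) (int q + 2) + moment (N - Suc r) (int q)))"
        by (intro sum.cong) (simp_all add: mom add_ac)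
      hence "c r i n = (\<Sum>N=Suc r..M. w i N * (2 * moment (N - Suc r) (int q + 1)
          + moment (N - Suc r) (int q + 2) + moment (N - Suc r) (int q)))"
        using 3 by (simp add: c_def split moment_0 add_ac)
      thus ?thesis using 3
        by (simp add: that c_def sum_distrib_left sum.distrib algebra_simps)
    qed
  qed
  have main: "(\<forall>h. strict_mono h \<longrightarrow> 0 \<le> col_minor (c r) h) \<and> col_minor (c M) k \<le> col_minor (c r) k"
    if "r \<le> M" for r
    using that
  proof (induction rule: inc_induct)
    case base
    show ?case using nonneg_M by simp
  next
    case (step r)
    note hyp = \<open>r < M\<close> step.IH
    define t where "t = (\<lambda>i n. c (Suc r) i n + of_bool (n > r) * c (Suc r) i (Suc n))"
    define m where "m = (\<lambda>n. if n < r then 0 else if n = r then 2 else (1::real))"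
    have le1: "col_minor (c (Suc r)) h \<le> col_minor t h" if "strict_mono h" for h
      unfolding t_def using hyp that by (intro col_minor_bidiagonal) auto
    have t: "0 \<le> col_minor t h" if "strict_mono h" for h
      using le1[OF that] hyp that by force
    have "c r = (\<lambda>i n. t i n + m n * t i (Suc n))"
      by (intro ext c_step[OF hyp(1) t_def m_def])
    hence le2: "col_minor t h \<le> col_minor (c r) h" if "strict_mono h" for h
      using col_minor_bidiagonal[of t m h] t that by (simp add: m_def)
    show ?case using le1 le2 t hyp k by (meson order_trans)
  qed
  have "c 0 = (\<lambda>i n. \<Sum>N\<le>M. w i N * moment N (int n))"
    by (simp add: c_def atMost_atLeast0)
  with main[of 0] M_eq show ?thesis by simp
qed

section \<open>Generalized Vandermonde determinants\<close>

text \<open>Rolle's theorem gives a zero of \<open>f'\<close> strictly between each point of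
  \<open>Z\<close> other than the last and its successor \<open>nxt\<close>. These gaps are
  disjoint, so the zeros are distinct.\<close>

lemma Rolle_finite_zeros:
  fixes f :: "real \<Rightarrow> real"
  assumes deriv: "\<And>x. (f has_real_derivative f' x) (at x)"
    and "finite Z" and zero: "\<And>z. z \<in> Z \<Longrightarrow> f z = 0"
  shows "\<exists>Z'. finite Z' \<and> card Z \<le> Suc (card Z') \<and> (\<forall>z\<in>Z'. f' z = 0)"
proof (cases "Z = {}")
  case True
  thus ?thesis by (intro exI[of _ "{}"]) auto
next
  case False
  define nxt where "nxt = (\<lambda>z. Min {w \<in> Z. z < w})"
  have nxt: "nxt z \<in> Z" "z < nxt z" if "z \<in> Z - {Max Z}" for z
  proof -
    have "Max Z \<in> {w \<in> Z. z < w}" using that \<open>finite Z\<close> False by (auto simp: less_le)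
    hence "nxt z \<in> {w \<in> Z. z < w}" unfolding nxt_def using \<open>finite Z\<close> by (intro Min_in) auto
    thus "nxt z \<in> Z" "z < nxt z" by auto
  qed
  have "\<exists>t. z < t \<and> t < nxt z \<and> f' t = 0" if "z \<in> Z - {Max Z}" for z
  proof -
    have "\<exists>t. z < t \<and> t < nxt z \<and> DERIV f t :> 0"
    proof (rule Rolle)
      show "z < nxt z" "f z = f (nxt z)" using nxt[OF that] that zero by auto
      show "continuous_on {z..nxt z} f"
        using deriv by (meson DERIV_isCont continuous_at_imp_continuous_on)
      show "f differentiable (at t)" for t using deriv real_differentiable_def by blast
    qed
    thus ?thesis using deriv DERIV_unique by blast
  qed
  then obtain g where g: "\<And>z. z \<in> Z - {Max Z} \<Longrightarrow> z < g z \<and> g z < nxt z \<and> f' (g z) = 0" by metis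
  have "g z < g z'" if "z \<in> Z - {Max Z}" "z' \<in> Z - {Max Z}" "z < z'" for z z'
  proof -
    have "nxt z \<le> z'" unfolding nxt_def using that \<open>finite Z\<close> by (intro Min_le) auto
    thus ?thesis using g[OF that(1)] g[OF that(2)] by linarith
  qed
  hence "inj_on g (Z - {Max Z})" by (intro linorder_inj_onI') (metis less_irrefl)
  hence "card (g ` (Z - {Max Z})) = card Z - 1"
    using \<open>finite Z\<close> False by (simp add: card_image)
  thus ?thesis using \<open>finite Z\<close> g by (intro exI[of _ "g ` (Z - {Max Z})"]) auto
qed

text \<open>Division by \<open>exp (b * t)\<close> makes the term of \<open>b\<close> constant, and
  differentiation removes it. Since Rolle costs at most one zero, induction yields
  \<open>c a * (a - b) = 0\<close> on the smaller set; any point of \<open>Z\<close> then gives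
  \<open>c b = 0\<close>.\<close>

lemma exp_sum_eq_0_imp_coeffs_0:
  fixes c :: "real \<Rightarrow> real"
  assumes "finite S" and "finite Z" "card S \<le> card Z"
    and "\<And>t. t \<in> Z \<Longrightarrow> (\<Sum>a\<in>S. c a * exp (a * t)) = 0"
  shows "\<forall>a\<in>S. c a = 0"
  using assms
proof (induction S arbitrary: c Z rule: finite_induct)
  case empty
  thus ?case by simp
next
  case (insert b S)
  define f where "f = (\<lambda>t. c b + (\<Sum>a\<in>S. c a * exp ((a - b) * t)))"
  define f' where "f' = (\<lambda>t. \<Sum>a\<in>S. c a * (a - b) * exp ((a - b) * t))"
  have "f t = exp (- (b * t)) * (\<Sum>a\<in>insert b S. c a * exp (a * t))" for t
    using insert.hyps
    by (simp add: f_def algebra_simps sum_distrib_left exp_minus exp_diff field_simps)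
  hence "f t = 0" if "t \<in> Z" for t using insert.prems(3)[OF that] by simp
  moreover have "(f has_real_derivative f' t) (at t)" for t
    unfolding f_def f'_def by (auto intro!: derivative_eq_intros sum.cong simp: mult_ac)
  ultimately obtain Z' where Z': "finite Z'" "card Z \<le> Suc (card Z')" "\<forall>t\<in>Z'. f' t = 0"
    using Rolle_finite_zeros[of f f' Z] insert.prems(1) by blast
  have "\<forall>a\<in>S. c a * (a - b) = 0"
  proof (rule insert.IH[OF Z'(1)])
    show "card S \<le> card Z'" using Z'(2) insert.prems(2) insert.hyps by simp
    fix t assume "t \<in> Z'"
    have "(\<Sum>a\<in>S. c a * (a - b) * exp (a * t)) = exp (b * t) * f' t"
      by (auto simp: f'_def sum_distrib_left algebra_simps simp flip: exp_add intro!: sum.cong)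
    thus "(\<Sum>a\<in>S. c a * (a - b) * exp (a * t)) = 0" using Z'(3) \<open>t \<in> Z'\<close> by simp
  qed
  hence S: "\<forall>a\<in>S. c a = 0" using insert.hyps by auto
  have "Z \<noteq> {}" using insert.prems(2) insert.hyps by auto
  then obtain t where "t \<in> Z" by blast
  have "c b * exp (b * t) = 0" using insert.prems(3)[OF \<open>t \<in> Z\<close>] insert.hyps S by simp
  thus ?case using S by simp
qed

text \<open>The entries of a kernel vector would be the coefficients of an exponential sum with as
  many terms as it has zeros \<open>y i\<close>.\<close>

lemma det_exp_nonzero:
  fixes y a :: "'l::finite \<Rightarrow> real"
  assumes "inj y" "inj a"
  shows "det (\<chi> i j. exp (y i * a j)) \<noteq> 0"
proof
  assume "det (\<chi> i j. exp (y i * a j)) = 0"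
  then obtain v where v: "(\<chi> i j. exp (y i * a j)) *v v = 0" "v \<noteq> 0"
    using invertible_det_nz invertible_left_inverse matrix_left_invertible_ker by metis
  define c where "c = (\<lambda>b. v $ inv a b)"
  have "\<forall>b\<in>range a. c b = 0"
  proof (rule exp_sum_eq_0_imp_coeffs_0[of _ "range y"])
    show "card (range a) \<le> card (range y)" using assms by (simp add: card_image)
    fix t assume "t \<in> range y"
    then obtain i where "t = y i" by blast
    have "(\<Sum>b\<in>range a. c b * exp (b * t)) = (\<Sum>j\<in>UNIV. c (a j) * exp (a j * t))"
      using assms by (simp add: sum.reindex)
    also have "\<dots> = ((\<chi> i j. exp (y i * a j)) *v v) $ i"
      using assms \<open>t = y i\<close> by (simp add: matrix_vector_mult_def c_def inv_f_f mult.commute)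
    finally show "(\<Sum>b\<in>range a. c b * exp (b * t)) = 0" using v by simp
  qed auto
  hence "v = 0" using assms by (auto simp: c_def vec_eq_iff inv_f_f)
  with v show False by simp
qed

lemma det_scale_rows_columns:
  fixes A :: "'l::finite \<Rightarrow> 'l \<Rightarrow> real"
  shows "det (\<chi> i j. p i * q j * A i j) = prod p UNIV * prod q UNIV * det (\<chi> i j. A i j)"
proof -
  have "det (\<chi> i j. p i * q j * A i j) = det (\<chi> i. p i *s (\<chi> j. q j * A i j))"
    by (intro arg_cong[where f = det]) (simp add: vec_eq_iff mult.assoc)
  also have "\<dots> = prod p UNIV * det (\<chi> i j. q j * A i j)" by (rule det_rows_mul)
  also have "det (\<chi> i j. q j * A i j) = det (transpose (\<chi> i j. q j * A i j))" by (rule det_transpose[symmetric])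
  also have "transpose (\<chi> i j. q j * A i j) = (\<chi> j. q j *s (\<chi> i. A i j))"
    by (simp add: vec_eq_iff transpose_def)
  also have "det \<dots> = prod q UNIV * det (\<chi> j i. A i j)" by (rule det_rows_mul)
  also have "(\<chi> j i. A i j) = transpose (\<chi> i j. A i j)" by (simp add: vec_eq_iff transpose_def)
  finally show ?thesis by simp
qed

lemma tendsto_det:
  fixes A :: "'b \<Rightarrow> real ^ 'l ^ 'l"
  assumes "\<And>i j. ((\<lambda>x. A x $ i $ j) \<longlongrightarrow> B $ i $ j) F"
  shows "((\<lambda>x. det (A x)) \<longlongrightarrow> det B) F"
  unfolding det_def by (intro tendsto_intros assms)

lemma continuous_on_det:
  fixes A :: "'b::topological_space \<Rightarrow> real ^ 'l ^ 'l"
  assumes "\<And>i j. continuous_on S (\<lambda>x. A x $ i $ j)"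
  shows "continuous_on S (\<lambda>x. det (A x))"
  unfolding det_def by (intro continuous_intros assms)

text \<open>
  Up to positive row and column factors the entries are \<open>exp (- t (r i - r j)\<^sup>2 / 2)\<close>, which
  tend to the identity matrix for large \<open>t\<close>.
\<close>

lemma det_exp_pos_diagonal:
  fixes r :: "'l::finite \<Rightarrow> real"
  assumes "inj r"
  shows "\<exists>t>0. 0 < det (\<chi> i j. exp (t * r i * r j))"
proof -
  have "((\<lambda>t. det (\<chi> i j. exp (- (t * ((r i - r j)\<^sup>2 / 2))))) \<longlongrightarrow> det (mat 1 :: real^'l^'l)) at_top"
  proof (rule tendsto_det)
    fix i j
    show "((\<lambda>t. (\<chi> i j. exp (- (t * ((r i - r j)\<^sup>2 / 2)))) $ i $ j) \<longlongrightarrow> (mat 1 :: real^'l^'l) $ i $ j) at_top"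
    proof (cases "i = j")
      case False
      hence "(r i - r j)\<^sup>2 / 2 > 0" using assms by (auto dest: injD)
      hence "filterlim (\<lambda>t. t * ((r i - r j)\<^sup>2 / 2)) at_top at_top"
        by (intro filterlim_at_top_mult_tendsto_pos[OF tendsto_const]) (auto intro: filterlim_ident)
      hence "((\<lambda>t. exp (- (t * ((r i - r j)\<^sup>2 / 2)))) \<longlongrightarrow> 0) at_top"
        by (intro filterlim_compose[OF exp_at_bot]) (simp add: filterlim_uminus_at_top)
      thus ?thesis using False by (simp add: mat_def)
    qed (simp add: mat_def)
  qed
  hence "\<forall>\<^sub>F t in at_top. 0 < det (\<chi> i j. exp (- (t * ((r i - r j)\<^sup>2 / 2))))"
    by (rule order_tendstoD) simp
  from eventually_happens'[OF _ eventually_conj[OF eventually_gt_at_top[of "0::real"] this]]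
  obtain t where t: "t > 0" "0 < det (\<chi> i j. exp (- (t * ((r i - r j)\<^sup>2 / 2))))"
    by auto
  have "exp (t * r i * r j) = exp (t * (r i)\<^sup>2 / 2) * exp (t * (r j)\<^sup>2 / 2) * exp (- (t * ((r i - r j)\<^sup>2 / 2)))" for i j
    by (simp flip: exp_add) (simp add: power2_eq_square field_simps)
  hence "0 < det (\<chi> i j. exp (t * r i * r j))"
    using t(2) by (simp only: det_scale_rows_columns) (auto intro!: mult_pos_pos prod_pos)
  thus ?thesis using t by blast
qed

text \<open>Both parameter families are moved along straight lines to one where the determinant is
  known to be positive. They stay strictly increasing, so the determinant never vanishes on the way
  and cannot change sign.\<close>

lemma det_exp_pos:
  fixes y a :: "'l::{finite,linorder} \<Rightarrow> real"
  assumes y: "strict_mono y" and a: "strict_mono a"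
  shows "0 < det (\<chi> i j. exp (y i * a j))"
proof (rule ccontr)
  assume neg: "\<not> 0 < det (\<chi> i j. exp (y i * a j))"
  \<comment> \<open>The rank of \<open>i\<close>, a convenient strictly increasing real function on
    the index type.\<close>
  define r where "r = (\<lambda>i::'l. real (card {..<i}))"
  have r: "strict_mono r"
    unfolding r_def strict_mono_def by (auto intro!: psubset_card_mono)
  obtain t where t: "t > 0" "0 < det (\<chi> i j. exp (t * r i * r j))"
    using det_exp_pos_diagonal[of r] r strict_mono_imp_inj_on by blast
  define F where "F = (\<lambda>s. det (\<chi> i j. exp (((1 - s) * y i + s * (t * r i)) * ((1 - s) * a j + s * r j))))"
  have "continuous_on {0..1} F"
    unfolding F_def by (intro continuous_on_det) (auto intro!: continuous_intros)
  moreover have "F 0 \<le> 0" "0 \<le> F 1" using neg t by (simp_all add: F_def mult.assoc)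
  ultimately obtain s where s: "0 \<le> s" "s \<le> 1" "F s = 0" using IVT'[of F 0 0 1] by auto
  have mono: "strict_mono (\<lambda>i. (1 - s) * u i + s * v i)" if "strict_mono u" "strict_mono v" for u v :: "'l \<Rightarrow> real"
  proof (rule strict_monoI)
    fix i j :: 'l assume "i < j"
    hence "u i < u j" "v i < v j" using that by (auto simp: strict_mono_def)
    thus "(1 - s) * u i + s * v i < (1 - s) * u j + s * v j"
      using s by (cases "s = 0") (auto intro!: add_le_less_mono mult_left_mono)
  qed
  have "strict_mono (\<lambda>i. t * r i)" using r t by (simp add: strict_mono_def)
  hence "F s \<noteq> 0"
    unfolding F_def using mono r y a by (intro det_exp_nonzero strict_mono_imp_inj_on) auto
  with s show False by simp
qed

section \<open>Positivity of Bessel determinants\<close>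

text \<open>The truncated minors are bounded below by the Vandermonde minor of \<open>w\<close>.
  This bound is positive and independent of \<open>M\<close>, so the limit stays strictly positive;
  the row factors \<open>exp (x i)\<close> are then divided out.\<close>

lemma det_bessel_I_pos:
  fixes x :: "'l::{finite,linorder} \<Rightarrow> real" and k :: "'l \<Rightarrow> int"
  assumes x: "strict_mono x" "\<And>i. 0 < x i" and k: "strict_mono k" "\<And>j. 0 \<le> k j"
  shows "0 < det (\<chi> i j. bessel_I (k j) (x i))"
proof -
  define \<kappa> where "\<kappa> = (\<lambda>j. nat (k j))"
  have k_eq: "k j = int (\<kappa> j)" for j using k(2) by (simp add: \<kappa>_def)
  have \<kappa>: "strict_mono \<kappa>" using k(1) by (simp add: strict_mono_def k_eq)
  define w where "w = (\<lambda>i n. (x i / 2) ^ n / fact n)"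
  define S where "S = (\<lambda>M i n. \<Sum>N\<le>M. w i N * moment N (int n))"
  have pos: "0 < col_minor w h" if h: "strict_mono h" for h
  proof -
    \<comment> \<open>With \<open>ln (x i / 2)\<close> as row parameter the powers become an
      exponential kernel, up to the column factors \<open>1 / fact n\<close>.\<close>
    have w_eq: "w i n = 1 * (1 / fact n) * exp (ln (x i / 2) * real n)" for i n
      using x(2)[of i] by (simp add: w_def powr_def flip: powr_realpow add: mult.commute)
    have "col_minor w h = det (transpose (\<chi> i j. w i (h j)))"
      by (simp add: col_minor_def transpose_def)
    also have "\<dots> = (\<Prod>i\<in>(UNIV :: 'l set). 1) * (\<Prod>j\<in>UNIV. 1 / fact (h j)) * det (\<chi> i j. exp (ln (x i / 2) * real (h j)))"
      unfolding w_eq det_transpose by (rule det_scale_rows_columns)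
    also have "\<dots> > 0"
      using x h by (intro mult_pos_pos prod_pos det_exp_pos) (auto simp: strict_mono_def)
    finally show ?thesis .
  qed
  have "((\<lambda>M. col_minor (S M) \<kappa>) \<longlonglongrightarrow> col_minor (\<lambda>i n. exp (x i) * bessel_I (int n) (x i)) \<kappa>)"
    unfolding col_minor_def
  proof (rule tendsto_det)
    fix i j
    show "(\<lambda>M. (\<chi> j i. S M i (\<kappa> j)) $ i $ j) \<longlonglongrightarrow>
        (\<chi> j i. exp (x i) * bessel_I (int (\<kappa> j)) (x i)) $ i $ j"
      using moment_sums[of "x j" "int (\<kappa> i)"] by (simp add: S_def w_def sums_def_le)
  qed
  moreover have "\<forall>\<^sub>F M in sequentially. col_minor w \<kappa> \<le> col_minor (S M) \<kappa>"
    using eventually_ge_at_top[of "Max (range \<kappa>)"]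
  proof eventually_elim
    case (elim M)
    hence "\<kappa> j \<le> M" for j by (meson Max_ge finite finite_imageI order_trans rangeI)
    thus ?case unfolding S_def using pos \<kappa> by (intro col_minor_le_moment_sum) (auto intro: less_imp_le)
  qed
  ultimately have "col_minor w \<kappa> \<le> col_minor (\<lambda>i n. exp (x i) * bessel_I (int n) (x i)) \<kappa>"
    by (intro tendsto_lowerbound) auto
  hence "0 < det (transpose (\<chi> i j. exp (x i) * bessel_I (k j) (x i)))"
    using pos[OF \<kappa>] by (simp add: col_minor_def k_eq transpose_def)
  also have "\<dots> = det (\<chi> i j. exp (x i) * 1 * bessel_I (k j) (x i))" by (simp only: det_transpose mult_1_right)
  also have "\<dots> = (\<Prod>i\<in>UNIV. exp (x i)) * (\<Prod>j\<in>(UNIV :: 'l set). 1) * det (\<chi> i j. bessel_I (k j) (x i))"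
    by (rule det_scale_rows_columns)
  finally have "0 < (\<Prod>i\<in>UNIV. exp (x i)) * det (\<chi> i j. bessel_I (k j) (x i))" by simp
  thus ?thesis by (rule zero_less_mult_pos) (simp add: prod_pos)
qed

section \<open>Increasing enumerations and independence of Bessel vectors\<close>

text \<open>An index goes to the entry of the sorted list of \<open>P\<close> whose position is the
  rank of the index.\<close>

lemma ex_strict_mono_enumeration:
  fixes P :: "'b::linorder set"
  assumes "finite P" "card P = CARD('m::{finite,linorder})"
  shows "\<exists>e :: 'm \<Rightarrow> 'b. strict_mono e \<and> range e = P"
proof -
  define e where "e = (\<lambda>i::'m. sorted_list_of_set P ! card {..<i})"
  have len: "card {..<i} < length (sorted_list_of_set P)" for i :: 'm
    using assms by (auto intro!: psubset_card_mono)
  have "strict_mono e"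
  proof (rule strict_monoI)
    fix i j :: 'm assume "i < j"
    hence "card {..<i} < card {..<j}" by (intro psubset_card_mono) auto
    thus "e i < e j" unfolding e_def
      by (intro sorted_wrt_nth_less[OF strict_sorted_list_of_set] len)
  qed
  moreover have "range e \<subseteq> P"
    using nth_mem[OF len] assms by (auto simp: e_def)
  hence "range e = P"
    using assms \<open>strict_mono e\<close> by (intro card_subset_eq) (auto simp: card_image strict_mono_imp_inj_on)
  ultimately show ?thesis by blast
qed

text \<open>At the smallest \<open>i\<close> where the functions differ, \<open>g\<close> takes the
  value \<open>f i\<close> only at some \<open>j \<ge> i\<close>, since earlier values of
  \<open>g\<close> are earlier values of \<open>f\<close>. Hence \<open>g i \<le> f i\<close>, and
  the converse follows by symmetry.\<close>

lemma strict_mono_eq_if_range_eq: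
  fixes f g :: "'a::{finite,linorder} \<Rightarrow> 'b::linorder"
  assumes f: "strict_mono f" and g: "strict_mono g" and range: "range f = range g"
  shows "f = g"
proof (rule ccontr)
  assume "f \<noteq> g"
  define i where "i = Min {i. f i \<noteq> g i}"
  have "i \<in> {i. f i \<noteq> g i}" unfolding i_def using \<open>f \<noteq> g\<close> by (intro Min_in) auto
  hence "f i \<noteq> g i" by simp
  have less: "f j = g j" if "j < i" for j
  proof (rule ccontr)
    assume "f j \<noteq> g j"
    hence "i \<le> j" unfolding i_def by (intro Min_le) auto
    with that show False by simp
  qed
  obtain j j' where j: "f i = g j" "g i = f j'" using range by (metis rangeE rangeI)
  have "i \<le> j" "i \<le> j'"
    using less j f g by (metis less_irrefl not_le strict_mono_less)+
  hence "g i \<le> g j" "f i \<le> f j'" using f g by (simp_all add: strict_mono_less_eq)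
  hence "g i \<le> f i" "f i \<le> g i" using j by simp_all
  thus False using \<open>f i \<noteq> g i\<close> by simp
qed

text \<open>Further positive points extend \<open>P\<close> to exactly \<open>CARD('m)\<close>
  points. Their vectors are the rows of a square Bessel matrix with nonzero determinant.\<close>

lemma v_vec_independent:
  fixes k :: "int ^ 'm::{finite,linorder}"
  assumes k: "k \<in> K_set" and "finite P" "card P \<le> CARD('m)" "P \<subseteq> {0<..}"
  shows "inj_on (v_vec k) P \<and> independent (v_vec k ` P)"
proof -
  have "infinite ({0<..} - P)" using \<open>finite P\<close> infinite_Ioi by simp
  then obtain B where B: "finite B" "card B = CARD('m) - card P" "B \<subseteq> {0<..} - P"
    using infinite_arbitrarily_large by blast
  have "card (P \<union> B) = CARD('m)"
    using assms B by (subst card_Un_disjoint) auto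
  then obtain e :: "'m \<Rightarrow> real" where e: "strict_mono e" "range e = P \<union> B"
    using ex_strict_mono_enumeration[of "P \<union> B"] B(1) \<open>finite P\<close> by auto
  define A where "A = (\<chi> i j. bessel_I (k $ j) (e i))"
  have "0 < e i" for i using e(2) B(3) assms(4) by (metis Un_iff greaterThan_iff rangeI subsetD DiffE)
  hence det: "det A \<noteq> 0"
    using det_bessel_I_pos[OF e(1), of "\<lambda>j. k $ j"] k
    by (simp add: A_def K_set_def strict_mono_def)
  have row: "row i A = v_vec k (e i)" for i by (simp add: A_def row_def v_vec_def)
  have "inj_on (v_vec k) (range e)"
  proof (rule inj_onI)
    fix s t assume "s \<in> range e" "t \<in> range e" and eq: "v_vec k s = v_vec k t"
    then obtain i j where ij: "s = e i" "t = e j" by blast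
    hence "row i A = row j A" using eq by (simp add: row)
    hence "i = j" using det det_identical_rows by blast
    thus "s = t" using ij by simp
  qed
  moreover have "rows A = v_vec k ` range e" by (auto simp: rows_def row)
  hence "independent (v_vec k ` range e)"
    using det det_dependent_rows[of A] by (auto simp: dependent_vec_eq)
  moreover have "P \<subseteq> range e" using e(2) by simp
  ultimately show ?thesis
    using inj_on_subset independent_mono image_mono by metis
qed

section \<open>Row spaces, Pluecker coordinates and openness of total positivity\<close>

lemma span_rows_imp_sum:
  fixes A :: "real ^ 'm ^ 'l"
  assumes "inj (\<lambda>i. row i A)" "v \<in> span (rows A)"
  shows "\<exists>c. v = (\<Sum>i\<in>UNIV. c i *\<^sub>R row i A)"
proof -
  have rows: "rows A = range (\<lambda>i. row i A)" by (auto simp: rows_def)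
  then obtain u where "v = (\<Sum>a\<in>rows A. u a *\<^sub>R a)"
    using assms(2) span_finite[of "rows A"] by auto
  thus ?thesis using assms(1) by (auto simp: rows sum.reindex)
qed

text \<open>The rows of \<open>B\<close> are combinations of the rows of \<open>A\<close>, so
  \<open>B\<close> is a square matrix times \<open>A\<close>, and \<open>d\<close> is the
  determinant of that square matrix.\<close>

lemma pluecker_change_of_basis:
  fixes A B :: "real ^ 'm::{finite,linorder} ^ 'l::{finite,linorder}"
  assumes "rows_basis_of A L" "rows_basis_of B L"
  shows "\<exists>d. \<forall>J. pluecker B J = d * pluecker A J"
proof -
  have "row i B \<in> span (rows A)" for i
    using assms span_superset[of "rows B"] by (auto simp: rows_basis_of_def rows_def)
  hence "\<exists>c. row i B = (\<Sum>h\<in>UNIV. c h *\<^sub>R row h A)" for i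
    using assms(1) by (intro span_rows_imp_sum) (auto simp: rows_basis_of_def)
  then obtain c where c: "\<And>i. row i B = (\<Sum>h\<in>UNIV. c i h *\<^sub>R row h A)" by metis
  have "B $ i $ j = (\<Sum>h\<in>UNIV. c i h * A $ h $ j)" for i j
    using arg_cong[OF c[of i], of "\<lambda>v. v $ j"] by (simp add: row_def)
  hence "(\<chi> i j. B $ i $ J j) = (\<chi> i h. c i h) ** (\<chi> i j. A $ i $ J j)" for J :: "'l \<Rightarrow> 'm"
    by (simp add: matrix_matrix_mult_def)
  hence "pluecker B J = det (\<chi> i h. c i h) * pluecker A J" for J
    by (simp add: pluecker_def det_mul)
  thus ?thesis by blast
qed

text \<open>By the quotient topology the claim concerns frames. Up to the scaling \<open>c\<close>,
  total positivity amounts to finitely many strict inequalities between continuous functions, and a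
  change of basis only alters \<open>c\<close>.\<close>

lemma openin_strictly_totally_positive:
  "openin (grassmannian_topology TYPE('l::{finite,linorder}))
    (strictly_totally_positive TYPE('l::{finite,linorder}) :: (real ^ 'm::{finite,linorder}) set set)"
  unfolding openin_grassmannian_topology
proof (intro conjI)
  show "strictly_totally_positive TYPE('l) \<subseteq> (grassmannian TYPE('l) :: (real ^ 'm::{finite,linorder}) set set)"
    by (auto simp: strictly_totally_positive_def)
  define U where "U = (\<Union>c\<in>-{0}. \<Inter>J\<in>Collect strict_mono.
    {A :: real ^ 'm::{finite,linorder} ^ 'l::{finite,linorder}. 0 < c * pluecker A J})"
  have "open U"
    unfolding U_def
    by (intro open_UN ballI open_INT open_Collect_less)
      (auto simp: pluecker_def intro!: continuous_intros continuous_on_det)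
  moreover have "{A \<in> frames. span (rows A) \<in> strictly_totally_positive TYPE('l)} = frames \<inter> U"
  proof (intro equalityI subsetI)
    fix A :: "real ^ 'm::{finite,linorder} ^ 'l::{finite,linorder}"
    assume "A \<in> {A \<in> frames. span (rows A) \<in> strictly_totally_positive TYPE('l)}"
    then obtain B :: "real ^ 'm::{finite,linorder} ^ 'l::{finite,linorder}" and c where A: "A \<in> frames"
      and B: "rows_basis_of B (span (rows A))" "c \<noteq> 0" "\<And>J. strict_mono J \<Longrightarrow> c * pluecker B J > 0"
      by (auto simp: strictly_totally_positive_def)
    obtain d where d: "\<And>J. pluecker B J = d * pluecker A J"
      using pluecker_change_of_basis[OF _ B(1)] A by (auto simp: frames_def)
    have "A \<in> U"
    proof (cases "d = 0")
      \<comment> \<open>If \<open>d = 0\<close>, all minors of \<open>B\<close> vanish, so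
        positivity leaves no increasing selection \<open>J\<close> at all, and membership in
        \<open>U\<close> is vacuous.\<close>
      case True
      hence "\<not> strict_mono J" for J :: "'l \<Rightarrow> 'm" using B(3)[of J] d by auto
      thus ?thesis by (auto simp: U_def intro!: bexI[of _ 1])
    next
      case False
      thus ?thesis using B(2,3) d by (auto simp: U_def mult.assoc intro!: bexI[of _ "c * d"])
    qed
    thus "A \<in> frames \<inter> U" using A by simp
  next
    fix A :: "real ^ 'm::{finite,linorder} ^ 'l::{finite,linorder}"
    assume A: "A \<in> frames \<inter> U"
    hence "span (rows A) \<in> grassmannian TYPE('l)" using frames_image by blast
    thus "A \<in> {A \<in> frames. span (rows A) \<in> strictly_totally_positive TYPE('l)}"
      using A by (auto simp: strictly_totally_positive_def frames_def U_def)
  qed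
  ultimately show "openin (top_of_set frames)
      {A \<in> frames. span (rows (A :: real ^ 'm::{finite,linorder} ^ 'l::{finite,linorder})) \<in> strictly_totally_positive TYPE('l)}"
    by (simp add: openin_open_Int)
qed

section \<open>Total positivity and injectivity of \<open>H_map\<close>\<close>

text \<open>Each minor at an increasing selection \<open>J\<close> is a Bessel determinant with the
  increasing orders \<open>k $ J j\<close>, so the scaling factor 1 suffices.\<close>

lemma H_map_strictly_totally_positive:
  fixes k :: "int ^ 'm::{finite,linorder}" and x :: "real ^ 'l::{finite,linorder}"
  assumes "CARD('l) \<le> CARD('m)" "k \<in> K_set" and x: "x \<in> X_set"
  shows "H_map k x \<in> strictly_totally_positive TYPE('l)"
proof -
  define A :: "real ^ 'm::{finite,linorder} ^ 'l::{finite,linorder}" where "A = (\<chi> i. v_vec k (x $ i))"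
  have x_mono: "strict_mono (\<lambda>i. x $ i)" and x_pos: "\<And>i. 0 < x $ i"
    using x by (auto simp: X_set_def strict_mono_def)
  note inj = strict_mono_imp_inj_on[OF x_mono]
  have ind: "inj_on (v_vec k) (range (\<lambda>i. x $ i)) \<and> independent (v_vec k ` range (\<lambda>i. x $ i))"
    using assms x_pos inj by (intro v_vec_independent) (auto simp: card_image)
  have row: "row i A = v_vec k (x $ i)" for i by (simp add: A_def row_def)
  have rows: "rows A = v_vec k ` range (\<lambda>i. x $ i)" by (auto simp: rows_def row)
  have H: "H_map k x = span (rows A)" by (simp add: H_map_def rows image_image)
  have basis: "rows_basis_of A (H_map k x)"
    using ind inj comp_inj_on[of "\<lambda>i. x $ i" UNIV "v_vec k"] by (simp add: rows_basis_of_def row rows H comp_def)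
  hence "H_map k x \<in> grassmannian TYPE('l)"
    using frames_image by (fastforce simp: frames_def H)
  moreover have "1 * pluecker A J > 0" if "strict_mono J" for J :: "'l \<Rightarrow> 'm"
    using det_bessel_I_pos[OF x_mono x_pos, of "\<lambda>j. k $ J j"] that \<open>k \<in> K_set\<close>
    by (simp add: pluecker_def A_def v_vec_def K_set_def strict_mono_def)
  ultimately show ?thesis
    unfolding strictly_totally_positive_def mem_Collect_eq
    by (intro conjI exI[of _ A] exI[of _ 1] basis) auto
qed

lemma inj_on_H_map:
  fixes k :: "int ^ 'm::{finite,linorder}"
  assumes card: "CARD('l::{finite,linorder}) < CARD('m)" and k: "k \<in> K_set"
  shows "inj_on (H_map k) (X_set :: (real ^ 'l::{finite,linorder}) set)"
proof (rule inj_onI)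
  fix x y :: "real ^ 'l::{finite,linorder}"
  assume xy: "x \<in> X_set" "y \<in> X_set" and eq: "H_map k x = H_map k y"
  have mono: "strict_mono (\<lambda>i. x $ i)" "strict_mono (\<lambda>i. y $ i)" and pos: "\<And>i. 0 < x $ i" "\<And>i. 0 < y $ i"
    using xy by (auto simp: X_set_def strict_mono_def)
  define P where "P = range (\<lambda>i. x $ i)"
  have P: "finite P" "card P = CARD('l)" using mono by (auto simp: P_def card_image strict_mono_imp_inj_on)
  have "y $ i \<in> P" for i
  proof (rule ccontr)
    assume new: "y $ i \<notin> P"
    \<comment> \<open>The enlarged set has \<open>CARD('l) + 1\<close> points; this is where the
      strict inequality of the dimensions enters.\<close>
    have "inj_on (v_vec k) (insert (y $ i) P) \<and> independent (v_vec k ` insert (y $ i) P)"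
      using P pos card k new by (intro v_vec_independent) (auto simp: P_def)
    hence "v_vec k (y $ i) \<notin> span (v_vec k ` P)"
      using new by (auto simp: independent_insert)
    moreover have "v_vec k (y $ i) \<in> H_map k y" by (auto simp: H_map_def intro: span_base)
    ultimately show False using eq by (simp add: H_map_def P_def image_image)
  qed
  hence "range (\<lambda>i. y $ i) = P"
    using P mono by (intro card_subset_eq) (auto simp: card_image strict_mono_imp_inj_on)
  thus "x = y"
    using strict_mono_eq_if_range_eq[OF mono] by (simp add: P_def fun_eq_iff vec_eq_iff)
qed

theorem corollary1p10:
  fixes k :: "int ^ 'm::{finite,linorder}"
  assumes "CARD('l::{finite,linorder}) < CARD('m)"
    and "k \<in> K_set"
  shows "(\<forall>x \<in> (X_set :: (real ^ 'l::{finite,linorder}) set).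
      H_map k x \<in> grassmannian TYPE('l)) \<and>
    inj_on (H_map k) (X_set :: (real ^ 'l::{finite,linorder}) set) \<and>
    openin (grassmannian_topology TYPE('l))
      (strictly_totally_positive TYPE('l) :: (real ^ 'm::{finite,linorder}) set set) \<and>
    H_map k ` (X_set :: (real ^ 'l::{finite,linorder}) set)
      \<subseteq> strictly_totally_positive TYPE('l)"
proof (intro conjI ballI image_subsetI)
  have stp: "H_map k x \<in> strictly_totally_positive TYPE('l)" if "x \<in> X_set" for x :: "real ^ 'l::{finite,linorder}"
    using H_map_strictly_totally_positive assms that less_imp_le by blast
  thus "x \<in> X_set \<Longrightarrow> H_map k x \<in> strictly_totally_positive TYPE('l)" for x :: "real ^ 'l::{finite,linorder}" .
  show "H_map k x \<in> grassmannian TYPE('l)" if "x \<in> X_set" for x :: "real ^ 'l::{finite,linorder}"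
    using stp[OF that] by (simp add: strictly_totally_positive_def)
qed (use assms inj_on_H_map openin_strictly_totally_positive in blast)+

end
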